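(* Let $d\ge 1$ be an integer. There exists a compact set $F\subseteq\mathbb{R}^d$ such that $\underline{\dim}_{\mathrm{B}}F=d$ but, for all integers $1\le k<d$, all $V\in G(d-k,d)$ and all $v\in V$, the slice $F\cap(V^{\perp}+v)$ consists of at most $k+1$ points.
   Context: $G(m,d)$ denotes the set of $m$-dimensional linear subspaces of $\mathbb{R}^d$, and $V^\perp$ is the orthogonal complement of $V$ in $\mathbb{R}^d$ (so $V^{\perp}+v$ is a $k$-dimensional affine plane when $V\in G(d-k,d)$). The lower box dimension of a non-empty bounded set is $\underline{\dim}_{\mathrm{B}} F=\liminf_{r\to 0}\frac{\log N_r(F)}{-\log r}$, where $N_r(F)$ is the minimal number of open sets of diameter at most $r$ needed to cover $F$. *)

theory Defs
  imports "HOL-Analysis.Analysis"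
begin

text \<open>
  Boundedness of the covering sets is required explicitly because \<^const>\<open>diameter\<close>
  is a real supremum, hence unspecified on unbounded sets.
  The covering number is meaningful for \<open>r > 0\<close> and totally bounded \<open>F\<close>; otherwise
  there need not be a finite cover, and the value is unspecified.
\<close>

definition covering_number :: "real \<Rightarrow> 'a::metric_space set \<Rightarrow> nat" where
  "covering_number r F =
     (LEAST n. \<exists>\<U>. finite \<U> \<and> card \<U> = n \<and>
        (\<forall>U\<in>\<U>. open U \<and> bounded U \<and> diameter U \<le> r) \<and> F \<subseteq> \<Union>\<U>)"

definition lower_box_dim :: "'a::metric_space set \<Rightarrow> ereal" where
  "lower_box_dim F =
     Liminf (at_right 0) (\<lambda>r::real. ereal (ln (real (covering_number r F)) / (- ln r)))"

definition grassmannian :: "nat \<Rightarrow> 'a::euclidean_space set set" where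
  "grassmannian m = {V. subspace V \<and> dim V = m}"

end

theory Submission
  imports Defs "HOL-Real_Asymp.Real_Asymp"
begin

text \<open>
  A countable set can have full box dimension: put at scale \<open>j\<close> a grid of \<open>2^(j^2)\<close> points per
  coordinate direction with spacing \<open>2^-(j^2+j)\<close> into a corner cube of side \<open>2^-j\<close>. The union of
  these grids accumulates only at the origin, and since \<open>j^2 / ((j+1)^2 + (j+1) + 1)\<close> tends to 1,
  the grids alone force lower box dimension \<open>d\<close>. Each grid point may be moved within a small ball
  without spoiling this, so all the points, together with the origin, can be chosen one after the
  other off the finitely many proper affine subspaces spanned by earlier ones. The resulting set is
  in general position, so a \<open>k\<close>-plane contains at most \<open>k + 1\<close> of its points.
\<close>

section \<open>General position\<close>

text \<open>The bound \<open>DIM('a) + 1\<close> is the largest size of an affinely independent set.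
  Smaller subsets are included so that sets with few points are constrained too.
  \<open>finite T\<close> is essential because \<open>card\<close> is 0 on infinite sets, which are
  always affinely dependent.\<close>

definition in_general_position :: "'a::euclidean_space set \<Rightarrow> bool" where
  "in_general_position S \<longleftrightarrow>
     (\<forall>T\<subseteq>S. finite T \<longrightarrow> card T \<le> DIM('a) + 1 \<longrightarrow> \<not> affine_dependent T)"

lemma in_general_position_subset:
  "in_general_position S \<Longrightarrow> T \<subseteq> S \<Longrightarrow> in_general_position T"
  by (auto simp: in_general_position_def)

text \<open>General position is tested on finite subsets only, and a finite subset of the union
  already lies in one member of the chain.\<close>

lemma in_general_position_UN_chain:
  fixes S :: "nat \<Rightarrow> 'a::euclidean_space set"
  assumes "incseq S" and gp: "\<And>n. in_general_position (S n)"
  shows "in_general_position (\<Union>n. S n)"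
  unfolding in_general_position_def
proof (intro allI impI)
  fix T assume T: "T \<subseteq> (\<Union>n. S n)" "finite T" "card T \<le> DIM('a) + 1"
  have "\<exists>n. T \<subseteq> S n"
    using T(2,1)
  proof (induction T rule: finite_induct)
    case (insert a T)
    then obtain m n where "T \<subseteq> S m" "a \<in> S n" by auto
    moreover have "S m \<subseteq> S (max m n)" "S n \<subseteq> S (max m n)"
      using \<open>incseq S\<close> by (simp_all add: incseqD)
    ultimately show ?case by blast
  qed simp
  then show "\<not> affine_dependent T"
    using gp T by (auto simp: in_general_position_def)
qed

lemma negligible_affine_hull_finite:
  fixes T :: "'a::euclidean_space set"
  assumes "finite T" "card T \<le> DIM('a)"
  shows "negligible (affine hull T)"
proof -
  have "aff_dim (affine hull T) < int DIM('a)"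
    using aff_dim_le_card[OF assms(1)] assms(2) by simp
  then have "interior (affine hull T) = {}"
    using aff_dim_nonempty_interior[of "affine hull T"] by auto
  then show ?thesis
    by (simp add: negligible_convex_interior affine_imp_convex)
qed

text \<open>The forbidden positions for a new point are the affine hulls of at most
  \<open>DIM('a)\<close> points of \<open>A\<close>. These are finitely many null sets, so they
  cannot cover a non-empty open set.\<close>

lemma in_general_position_extend:
  fixes A :: "'a::euclidean_space set"
  assumes "finite A" "in_general_position A" "open U" "U \<noteq> {}"
  obtains x where "x \<in> U" "in_general_position (insert x A)"
proof -
  define H where "H = \<Union> ((\<lambda>T. affine hull T) ` {T. T \<subseteq> A \<and> card T \<le> DIM('a)})"
  have "negligible H"
    unfolding H_def
    using \<open>finite A\<close>
    by (intro negligible_Union) (auto intro!: negligible_affine_hull_finite dest: finite_subset)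
  then have "\<not> U \<subseteq> H"
    using open_not_negligible[OF assms(3,4)] negligible_subset by blast
  then obtain x where x: "x \<in> U" "x \<notin> H" by blast
  have "in_general_position (insert x A)"
    unfolding in_general_position_def
  proof (intro allI impI)
    fix T assume T: "T \<subseteq> insert x A" "finite T" "card T \<le> DIM('a) + 1"
    show "\<not> affine_dependent T"
    proof (cases "x \<in> T")
      case True
      have "\<not> affine_dependent (T - {x})"
        using assms(2) T True by (auto simp: in_general_position_def subset_insert_iff)
      \<comment> \<open>Removing \<open>x\<close> leaves at most \<open>DIM('a)\<close> points of
        \<open>A\<close>, so this hull is one of those collected in \<open>H\<close>.\<close>
      moreover have "x \<notin> affine hull (T - {x})"
        using x(2) T True by (auto simp: H_def subset_insert_iff)
      ultimately show ?thesis
        using affine_independent_insert[of "T - {x}" x] True by (simp add: insert_absorb)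
    next
      case False
      then show ?thesis
        using assms(2) T by (auto simp: in_general_position_def subset_insert_iff)
    qed
  qed
  with x(1) show ?thesis by (rule that)
qed

text \<open>Stage \<open>n\<close> of a recursion started at \<open>{a}\<close> adds a point of
  \<open>U (from_nat n)\<close>. The point finally assigned to \<open>i\<close> is the one added at
  stage \<open>to_nat i\<close>; points added at other stages are discarded at the end.\<close>

lemma in_general_position_selection:
  fixes U :: "'i::countable \<Rightarrow> 'a::euclidean_space set" and a :: 'a
  assumes U: "\<And>i. open (U i)" "\<And>i. U i \<noteq> {}"
  obtains x where "\<And>i. x i \<in> U i" "in_general_position (insert a (range x))"
proof -
  have "\<exists>S. \<forall>n. (finite (S n) \<and> in_general_position (S n) \<and> a \<in> S n) \<and>
          (\<exists>y \<in> U (from_nat n). S (Suc n) = insert y (S n))"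
  proof (rule dependent_nat_choice)
    have "in_general_position {a}"
      unfolding in_general_position_def by (auto simp: subset_singleton_iff)
    then show "\<exists>S. finite S \<and> in_general_position S \<and> a \<in> S" by blast
  next
    fix S n assume "finite S \<and> in_general_position S \<and> a \<in> S"
    with in_general_position_extend[of S "U (from_nat n)"] U
    show "\<exists>S'. (finite S' \<and> in_general_position S' \<and> a \<in> S') \<and>
            (\<exists>y \<in> U (from_nat n). S' = insert y S)"
      by (metis finite_insert insertCI)
  qed
  then obtain S where gp: "\<And>n. in_general_position (S n)" and a: "\<And>n. a \<in> S n"
    and step: "\<And>n. \<exists>y. y \<in> U (from_nat n) \<and> S (Suc n) = insert y (S n)"
    by blast
  from step obtain y where y: "\<And>n. y n \<in> U (from_nat n)" "\<And>n. S (Suc n) = insert (y n) (S n)"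
    by metis
  have "incseq S"
    by (rule incseq_SucI) (auto simp: y(2))
  then have "in_general_position (\<Union>n. S n)"
    using gp by (rule in_general_position_UN_chain)
  moreover have "insert a (range (\<lambda>i. y (to_nat i))) \<subseteq> (\<Union>n. S n)"
    using a y(2) by blast
  ultimately have "in_general_position (insert a (range (\<lambda>i. y (to_nat i))))"
    by (rule in_general_position_subset)
  moreover have "y (to_nat i) \<in> U i" for i
    using y(1)[of "to_nat i"] by simp
  ultimately show ?thesis by (intro that[of "\<lambda>i. y (to_nat i)"])
qed

text \<open>If the intersection is infinite or too large, it contains k + 2 points. As k <
  \<open>DIM('a)\<close>, general position applies to them, so they span dimension k + 1, which does
  not fit into \<open>P\<close>.\<close>

lemma in_general_position_Int_low_dim:
  fixes F P :: "'a::euclidean_space set"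
  assumes "in_general_position F" "aff_dim P = int k" "k < DIM('a)"
  shows "finite (F \<inter> P) \<and> card (F \<inter> P) \<le> k + 1"
proof (rule ccontr)
  assume many: "\<not> ?thesis"
  obtain T where T: "T \<subseteq> F \<inter> P" "finite T" "card T = k + 2"
  proof (cases "finite (F \<inter> P)")
    case True
    with many have "k + 2 \<le> card (F \<inter> P)" by simp
    then show ?thesis using that True by (metis obtain_subset_with_card_n)
  next
    case False
    then show ?thesis using that infinite_arbitrarily_large by metis
  qed
  then have "\<not> affine_dependent T"
    using assms(1,3) by (auto simp: in_general_position_def)
  then have "aff_dim T = int k + 1"
    using aff_dim_affine_independent[of T] T(3) by simp
  moreover have "aff_dim T \<le> aff_dim P"
    using T(1) by (intro aff_dim_subset) auto
  ultimately show False using assms(2) by simp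
qed

lemma aff_dim_orthogonal_comp_translate:
  fixes V :: "'a::euclidean_space set"
  assumes "subspace V"
  shows "aff_dim ((\<lambda>x. x + v) ` (V\<^sup>\<bottom>)) = int (DIM('a) - dim V)"
proof -
  have "dim (V\<^sup>\<bottom>) + dim V = DIM('a)"
    using dim_subspace_orthogonal_to_vectors[OF assms subspace_UNIV]
    by (simp add: orthogonal_comp_def)
  moreover have "(\<lambda>x. x + v) ` (V\<^sup>\<bottom>) = (+) v ` (V\<^sup>\<bottom>)"
    by (simp add: add.commute)
  ultimately show ?thesis
    by (simp only: aff_dim_translation_eq aff_dim_subspace[OF subspace_orthogonal_comp])
qed

section \<open>Covering numbers\<close>

text \<open>Balls centred at a grid cover \<open>F\<close>. The result serves twice: its count
  bounds the dimension from above, and its existence part makes the \<open>LEAST\<close> in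
  \<open>covering_number\<close> meaningful.\<close>

lemma bounded_grid_cover:
  fixes F :: "(real ^ 'n::finite) set"
  assumes "bounded F"
  obtains C where "C \<ge> 1" and
    "\<And>r. 0 < r \<Longrightarrow> r \<le> 1 \<Longrightarrow> \<exists>\<U>. finite \<U> \<and> real (card \<U>) \<le> (C / r) ^ CARD('n) \<and>
        (\<forall>U\<in>\<U>. open U \<and> bounded U \<and> diameter U \<le> r) \<and> F \<subseteq> \<Union>\<U>"
proof -
  obtain B where B: "B > 0" "\<And>x. x \<in> F \<Longrightarrow> norm x \<le> B"
    using assms bounded_pos by metis
  define d where "d = real CARD('n)"
  have d: "d > 0" by (simp add: d_def)
  \<comment> \<open>The count per coordinate comes out as at most 4 * d * B / r + 5, and r \<le> 1
    lets the 5 be absorbed into 5 / r.\<close>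
  define C where "C = 4 * d * B + 5"
  show ?thesis
  proof (rule that[of C])
    show "C \<ge> 1" using B(1) d by (simp add: C_def)
    fix r :: real assume r: "0 < r" "r \<le> 1"
    \<comment> \<open>Rounding to the grid changes each of the d coordinates by less than s, hence
      moves the point by less than d * s = r / 2, the radius of the balls.\<close>
    define s where "s = r / (2 * d)"
    have s: "s > 0" using r d by (simp add: s_def)
    define M where "M = \<lceil>B / s\<rceil> + 1"
    define P where "P = PiE (UNIV :: 'n set) (\<lambda>_. {-M..M})"
    define c :: "('n \<Rightarrow> int) \<Rightarrow> real ^ 'n" where "c f = (\<chi> i. s * of_int (f i))" for f
    define \<U> where "\<U> = (\<lambda>f. ball (c f) (r / 2)) ` P"
    have "finite P" by (auto simp: P_def intro!: finite_PiE)
    have M: "M \<ge> 0" using B(1) s unfolding M_def by (smt (verit) divide_pos_pos zero_less_ceiling)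
    have "card P = nat (2 * M + 1) ^ CARD('n)"
      by (simp add: P_def card_PiE algebra_simps)
    then have "real (card \<U>) \<le> real (nat (2 * M + 1) ^ CARD('n))"
      using card_image_le[OF \<open>finite P\<close>, of "\<lambda>f. ball (c f) (r / 2)"] by (simp add: \<U>_def)
    also have "\<dots> = (of_int (2 * M + 1)) ^ CARD('n)"
      using M by (simp add: of_nat_nat)
    also have "\<dots> \<le> (C / r) ^ CARD('n)"
    proof (rule power_mono)
      have "real_of_int M \<le> B / s + 2" unfolding M_def by linarith
      then have "real_of_int (2 * M + 1) \<le> 2 * (B / s) + 5" by simp
      also have "\<dots> \<le> C / r"
        using r d by (simp add: C_def s_def field_simps)
      finally show "real_of_int (2 * M + 1) \<le> C / r" .
    qed (use M in auto)
    finally have card: "real (card \<U>) \<le> (C / r) ^ CARD('n)" .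
    have cover: "F \<subseteq> \<Union>\<U>"
    proof
      fix x assume x: "x \<in> F"
      define f where "f = (\<lambda>i. \<lfloor>x $ i / s\<rfloor>)"
      have "f i \<in> {-M..M}" for i
      proof -
        have "\<bar>x $ i\<bar> \<le> B"
          using component_le_norm_cart[of x i] B(2)[OF x] by linarith
        then have "\<bar>x $ i / s\<bar> \<le> B / s"
          using s by (simp add: abs_divide divide_right_mono)
        then show ?thesis
          unfolding f_def M_def by (simp, linarith)
      qed
      then have "f \<in> P" by (auto simp: P_def)
      have "\<bar>(c f - x) $ i\<bar> < s" for i
      proof -
        have "\<bar>of_int \<lfloor>x $ i / s\<rfloor> - x $ i / s\<bar> < 1" by linarith
        then have "s * \<bar>of_int \<lfloor>x $ i / s\<rfloor> - x $ i / s\<bar> < s * 1"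
          using s by (intro mult_strict_left_mono) auto
        moreover have "(c f - x) $ i = s * (of_int \<lfloor>x $ i / s\<rfloor> - x $ i / s)"
          using s by (simp add: c_def f_def field_simps)
        ultimately show ?thesis using s by (simp add: abs_mult)
      qed
      then have "(\<Sum>i\<in>UNIV. \<bar>(c f - x) $ i\<bar>) < (\<Sum>i\<in>(UNIV::'n set). s)"
        by (intro sum_strict_mono) auto
      also have "\<dots> = r / 2" using d by (simp add: s_def d_def)
      finally have "dist (c f) x < r / 2"
        using norm_le_l1_cart[of "c f - x"] by (simp add: dist_norm)
      with \<open>f \<in> P\<close> show "x \<in> \<Union>\<U>" by (auto simp: \<U>_def)
    qed
    show "\<exists>\<U>. finite \<U> \<and> real (card \<U>) \<le> (C / r) ^ CARD('n) \<and>
        (\<forall>U\<in>\<U>. open U \<and> bounded U \<and> diameter U \<le> r) \<and> F \<subseteq> \<Union>\<U>"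
      using card cover \<open>finite P\<close> r by (intro exI[of _ \<U>]) (auto simp: \<U>_def)
  qed
qed

lemma covering_number_le_card:
  assumes "finite \<U>" "\<And>U. U \<in> \<U> \<Longrightarrow> open U \<and> bounded U \<and> diameter U \<le> r" "F \<subseteq> \<Union>\<U>"
  shows "covering_number r F \<le> card \<U>"
  unfolding covering_number_def by (rule Least_le) (use assms in blast)

text \<open>A set of diameter at most r contains at most one point of \<open>P\<close>, so choosing
  a covering set for each point is injective into a minimal cover.\<close>

lemma card_separated_le_covering_number:
  fixes F :: "(real ^ 'n::finite) set"
  assumes F: "bounded F" and r: "0 < r" "r \<le> 1"
    and P: "P \<subseteq> F" "\<And>x y. x \<in> P \<Longrightarrow> y \<in> P \<Longrightarrow> x \<noteq> y \<Longrightarrow> r < dist x y"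
  shows "card P \<le> covering_number r F"
proof -
  have "\<exists>n \<U>. finite \<U> \<and> card \<U> = n \<and>
      (\<forall>U\<in>\<U>. open U \<and> bounded U \<and> diameter U \<le> r) \<and> F \<subseteq> \<Union>\<U>"
    using bounded_grid_cover[OF F] r by metis
  from LeastI_ex[OF this]
  obtain \<U> where \<U>: "finite \<U>" "card \<U> = covering_number r F"
      "\<And>U. U \<in> \<U> \<Longrightarrow> bounded U \<and> diameter U \<le> r" "F \<subseteq> \<Union>\<U>"
    unfolding covering_number_def[symmetric] by blast
  have "\<forall>x\<in>P. \<exists>U\<in>\<U>. x \<in> U" using P(1) \<U>(4) by blast
  then obtain g where g: "\<And>x. x \<in> P \<Longrightarrow> g x \<in> \<U> \<and> x \<in> g x" by metis
  have "inj_on g P"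
  proof (rule inj_onI, rule ccontr)
    fix x y assume xy: "x \<in> P" "y \<in> P" "g x = g y" "x \<noteq> y"
    then have "dist x y \<le> diameter (g x)"
      using g \<U>(3) by (metis diameter_bounded_bound)
    with xy P(2) g \<U>(3) show False by (metis le_less_trans less_le_not_le order_trans)
  qed
  then have "card P \<le> card \<U>"
    using g \<U>(1) by (intro card_inj_on_le) auto
  then show ?thesis by (simp add: \<U>(2))
qed

text \<open>The grid cover gives ln N \<le> d * (ln C - ln r); after division by - ln r the constant
  C disappears in the limit.\<close>

lemma lower_box_dim_le_CARD:
  fixes F :: "(real ^ 'n::finite) set"
  assumes "bounded F"
  shows "lower_box_dim F \<le> ereal (real CARD('n))"
proof -
  define d where "d = real CARD('n)"
  obtain C where C: "C \<ge> 1" and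
    cov: "\<And>r. 0 < r \<Longrightarrow> r \<le> 1 \<Longrightarrow> \<exists>\<U>. finite \<U> \<and> real (card \<U>) \<le> (C / r) ^ CARD('n) \<and>
        (\<forall>U\<in>\<U>. open U \<and> bounded U \<and> diameter U \<le> r) \<and> F \<subseteq> \<Union>\<U>"
    using bounded_grid_cover[OF assms] by blast
  have bound: "ln (real (covering_number r F)) / (- ln r) \<le> d * (ln C - ln r) / (- ln r)"
    if r: "0 < r" "r < 1" for r
  proof -
    obtain \<U> where \<U>: "finite \<U>" "real (card \<U>) \<le> (C / r) ^ CARD('n)"
        "\<forall>U\<in>\<U>. open U \<and> bounded U \<and> diameter U \<le> r" "F \<subseteq> \<Union>\<U>"
      using cov[of r] r by auto
    have "covering_number r F \<le> card \<U>"
      using \<U> by (intro covering_number_le_card) auto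
    with \<U>(2) have N: "real (covering_number r F) \<le> (C / r) ^ CARD('n)" by linarith
    have "C / r \<ge> 1" using C r by simp
    have "ln (real (covering_number r F)) \<le> d * ln (C / r)"
    proof (cases "covering_number r F = 0")
      \<comment> \<open>This occurs for empty \<open>F\<close>; the convention
        \<open>ln 0 = 0\<close> keeps the bound valid.\<close>
      case True
      then show ?thesis using \<open>C / r \<ge> 1\<close> by (simp add: d_def)
    next
      case False
      then have "ln (real (covering_number r F)) \<le> ln ((C / r) ^ CARD('n))"
        using N by (subst ln_le_cancel_iff) (use \<open>C / r \<ge> 1\<close> C r in auto)
      then show ?thesis using C r by (simp add: d_def ln_realpow)
    qed
    also have "ln (C / r) = ln C - ln r" using C r by (simp add: ln_div)
    finally show ?thesis using r by (intro divide_right_mono) auto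
  qed
  have "eventually (\<lambda>r::real. 0 < r \<and> r < 1) (at_right 0)"
    unfolding eventually_at_right_field by (intro exI[of _ 1]) auto
  then have "lower_box_dim F \<le> Liminf (at_right 0) (\<lambda>r. ereal (d * (ln C - ln r) / (- ln r)))"
    unfolding lower_box_dim_def by (intro Liminf_mono) (use bound in \<open>force elim!: eventually_mono simp del: divide_minus_right\<close>)
  also have "\<dots> = ereal d"
  proof (rule lim_imp_Liminf)
    have "C > 0" using C by simp
    then have "((\<lambda>r. d * (ln C - ln r) / (- ln r)) \<longlongrightarrow> d) (at_right 0)"
      by real_asymp
    then show "((\<lambda>r. ereal (d * (ln C - ln r) / (- ln r))) \<longlongrightarrow> ereal d) (at_right 0)"
      by simp
  qed simp
  finally show ?thesis by (simp add: d_def)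
qed

text \<open>Every small r lies between two consecutive separation scales, and \<open>P j\<close> at
  the coarser one bounds the covering number from below. Both exponents grow like j^2, so being off
  by one scale costs nothing in the limit.\<close>

lemma CARD_le_lower_box_dim:
  fixes F :: "(real ^ 'n::finite) set"
  assumes F: "bounded F"
    and P: "\<And>j. P j \<subseteq> F" "\<And>j. card (P j) = 2 ^ (CARD('n) * j\<^sup>2)"
    and sep: "\<And>j x y. x \<in> P j \<Longrightarrow> y \<in> P j \<Longrightarrow> x \<noteq> y \<Longrightarrow> 1 / 2 ^ (j\<^sup>2 + j + 1) < dist x y"
  shows "ereal (real CARD('n)) \<le> lower_box_dim F"
  unfolding lower_box_dim_def le_Liminf_iff
proof (intro allI impI)
  define d where "d = real CARD('n)"
  \<comment> \<open>A lower bound for the quotient when \<open>\<rho> (Suc j)\<close> < r \<le>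
    \<open>\<rho> j\<close>: the numerator comes from the cardinality of \<open>P j\<close>, the
    denominator is the exponent (j + 1)^2 + (j + 1) + 1 in \<open>\<rho> (Suc j)\<close>, and the
    factors ln 2 cancel.\<close>
  define q where "q j = d * real j ^ 2 / ((real j + 1) ^ 2 + real j + 2)" for j
  define \<rho> where "\<rho> j = 1 / (2::real) ^ (j\<^sup>2 + j + 1)" for j :: nat
  have \<rho>_mono: "\<rho> n \<le> \<rho> m" if "m \<le> n" for m n
    using that unfolding \<rho>_def
    by (intro divide_left_mono power_increasing add_mono power_mono) auto
  fix y :: ereal assume y: "y < ereal (real CARD('n))"
  have "q \<longlonglongrightarrow> d"
    unfolding q_def by real_asymp
  then have "(\<lambda>j. ereal (q j)) \<longlonglongrightarrow> ereal d" by simp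
  from order_tendstoD(1)[OF this, of y] y
  obtain J where J: "\<And>j. j \<ge> J \<Longrightarrow> y < ereal (q j)"
    by (auto simp: eventually_sequentially d_def)
  have "y < ereal (ln (real (covering_number r F)) / (- ln r))" if r: "0 < r" "r < \<rho> J" for r
  proof -
    have "\<rho> \<longlonglongrightarrow> 0"
    proof (rule tendsto_sandwich[of "\<lambda>_. 0" _ _ "\<lambda>j. 1 / 2 ^ j"])
      show "\<forall>\<^sub>F j in sequentially. \<rho> j \<le> 1 / 2 ^ j"
        unfolding \<rho>_def
        by (intro always_eventually allI divide_left_mono power_increasing) auto
      show "(\<lambda>j. 1 / 2 ^ j :: real) \<longlonglongrightarrow> 0" by real_asymp
    qed (auto simp: \<rho>_def)
    then have "\<exists>m. \<rho> m < r"
      using order_tendstoD(2)[of \<rho> 0 sequentially r] r(1) by (auto simp: eventually_sequentially)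
    then have least: "\<rho> (LEAST m. \<rho> m < r) < r" by (rule LeastI_ex)
    \<comment> \<open>The least index exceeds \<open>J\<close>, so it is a successor
      \<open>Suc j\<close> with j \<ge> \<open>J\<close>, and minimality gives r \<le>
      \<open>\<rho> j\<close>.\<close>
    then have "\<not> (LEAST m. \<rho> m < r) \<le> J"
      using \<rho>_mono[of "LEAST m. \<rho> m < r" J] r(2) by linarith
    then obtain j where j: "(LEAST m. \<rho> m < r) = Suc j" "J \<le> j"
      by (metis Suc_le_mono not_less_eq_eq old.nat.exhaust zero_le)
    have lo: "\<rho> (Suc j) < r" using least j(1) by simp
    have hi: "r \<le> \<rho> j" using not_less_Least[of j "\<lambda>m. \<rho> m < r"] j(1) by simp
    \<comment> \<open>The exponent is positive even for j = 0, so r < 1 and the denominator - ln r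
      is positive.\<close>
    have "\<rho> j < 1" unfolding \<rho>_def by (simp add: one_less_power del: power_Suc)
    then have "r < 1" using hi by simp
    have "card (P j) \<le> covering_number r F"
      by (rule card_separated_le_covering_number[OF F r(1) _ P(1)])
        (use hi sep[of _ j] \<open>r < 1\<close> in \<open>force simp: \<rho>_def\<close>)+
    then have "(2::real) ^ (CARD('n) * j\<^sup>2) \<le> real (covering_number r F)"
      unfolding P(2) using of_nat_mono by fastforce
    then have "ln ((2::real) ^ (CARD('n) * j\<^sup>2)) \<le> ln (real (covering_number r F))"
      by (intro ln_mono) auto
    then have num: "d * real j ^ 2 * ln 2 \<le> ln (real (covering_number r F))"
      by (simp add: ln_realpow d_def)
    have "ln (\<rho> (Suc j)) < ln r"
      using lo r(1) by (intro ln_strict_mono) (auto simp: \<rho>_def)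
    moreover have "ln (\<rho> (Suc j)) = - (((real j + 1) ^ 2 + real j + 2) * ln 2)"
      unfolding \<rho>_def by (simp add: ln_div ln_realpow del: power_Suc)
    ultimately have den: "- ln r \<le> ((real j + 1) ^ 2 + real j + 2) * ln 2" by linarith
    have "q j = d * real j ^ 2 * ln 2 / (((real j + 1) ^ 2 + real j + 2) * ln 2)"
      by (simp add: q_def)
    also have "\<dots> \<le> ln (real (covering_number r F)) / (- ln r)"
    proof (rule frac_le)
      show "0 \<le> ln (real (covering_number r F))"
        by (rule order_trans[OF _ num]) (simp add: d_def)
    qed (use num den r(1) \<open>r < 1\<close> in auto)
    finally show ?thesis using J[OF j(2)] less_le_trans ereal_less_eq(3) by metis
  qed
  moreover have "\<rho> J > 0" by (simp add: \<rho>_def)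
  ultimately show "\<forall>\<^sub>F r in at_right 0. y < ereal (ln (real (covering_number r F)) / (- ln r))"
    unfolding eventually_at_right_field by blast
qed

text \<open>A member of the open cover that contains \<open>a\<close> swallows a ball around
  \<open>a\<close>, and only finitely many points remain to be covered.\<close>

lemma compact_if_finite_outside_balls:
  fixes a :: "'a::metric_space"
  assumes "a \<in> F" and fin: "\<And>e. e > 0 \<Longrightarrow> finite (F - ball a e)"
  shows "compact F"
proof (rule compactI)
  fix \<C> assume \<C>: "\<forall>t\<in>\<C>. open t" "F \<subseteq> \<Union>\<C>"
  then obtain t where t: "t \<in> \<C>" "a \<in> t" using assms(1) by blast
  then obtain e where e: "e > 0" "ball a e \<subseteq> t"
    using \<C>(1) by (meson openE)
  have "\<forall>x\<in>F - ball a e. \<exists>u\<in>\<C>. x \<in> u" using \<C>(2) by blast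
  then obtain g where g: "\<And>x. x \<in> F - ball a e \<Longrightarrow> g x \<in> \<C> \<and> x \<in> g x" by metis
  show "\<exists>\<C>'\<subseteq>\<C>. finite \<C>' \<and> F \<subseteq> \<Union>\<C>'"
  proof (intro exI conjI)
    show "insert t (g ` (F - ball a e)) \<subseteq> \<C>" using t g by blast
    show "finite (insert t (g ` (F - ball a e)))" using fin[OF e(1)] by simp
    show "F \<subseteq> \<Union>(insert t (g ` (F - ball a e)))" using e(2) g by blast
  qed
qed

section \<open>The perturbed grids and their union\<close>

theorem theorem10p3p2:
  shows "\<exists>F :: (real ^ 'n::finite) set.
    compact F \<and>
    lower_box_dim F = ereal (real CARD('n)) \<and>
    (\<forall>k. 1 \<le> k \<and> k < CARD('n) \<longrightarrow>
      (\<forall>V \<in> grassmannian (CARD('n) - k). \<forall>v \<in> V.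
        finite (F \<inter> (\<lambda>x. x + v) ` (V\<^sup>\<bottom>)) \<and>
        card (F \<inter> (\<lambda>x. x + v) ` (V\<^sup>\<bottom>)) \<le> k + 1))"
proof -
  define \<delta> where "\<delta> j = 1 / (2::real) ^ (j\<^sup>2 + j)" for j :: nat
  define G where "G j = PiE (UNIV :: 'n set) (\<lambda>_. {..<(2::nat) ^ j\<^sup>2})" for j :: nat
  define c :: "nat \<Rightarrow> ('n \<Rightarrow> nat) \<Rightarrow> real ^ 'n" where "c j f = (\<chi> i. \<delta> j * real (f i))" for j f
  have \<delta>: "\<delta> j > 0" for j by (simp add: \<delta>_def)
  \<comment> \<open>Distinct centres of one level are at least \<open>\<delta> j\<close> apart.
    Moving each by less than a quarter of that leaves more than \<open>\<delta> j / 2\<close>, which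
    is the separation 1 / 2 ^ (j^2 + j + 1) required later. The index type is countable because
    \<open>'n\<close> is finite; \<open>f\<close> ranges over all functions here and is cut down to
    \<open>G j\<close> only in \<open>P\<close>.\<close>
  define U where "U = (\<lambda>(j, f). ball (c j f) (\<delta> j / 4))"
  have "open (U i)" "U i \<noteq> {}" for i
    using \<delta> by (simp_all add: U_def case_prod_beta not_le)
  then obtain x where x: "\<And>i. x i \<in> U i" and gp: "in_general_position (insert 0 (range x))"
    using in_general_position_selection[of U 0] by blast
  have xc: "dist (c j f) (x (j, f)) < \<delta> j / 4" for j f
    using x[of "(j, f)"] by (simp add: U_def)
  have finG: "finite (G j)" for j by (auto simp: G_def intro!: finite_PiE)
  define P where "P j = (\<lambda>f. x (j, f)) ` G j" for j
  define F where "F = insert 0 (\<Union>j. P j)"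

  have sep: "\<delta> j / 2 < dist (x (j, f)) (x (j, g))" if "f \<noteq> g" for j :: nat and f g :: "'n \<Rightarrow> nat"
  proof -
    obtain i where i: "f i \<noteq> g i" using \<open>f \<noteq> g\<close> by blast
    then have "1 \<le> \<bar>real (f i) - real (g i)\<bar>" by linarith
    then have "\<delta> j * 1 \<le> \<delta> j * \<bar>real (f i) - real (g i)\<bar>"
      using \<delta>[of j] by (intro mult_left_mono) auto
    also have "\<dots> = \<bar>(c j f - c j g) $ i\<bar>"
      using \<delta>[of j] by (simp add: c_def abs_mult flip: right_diff_distrib)
    also have "\<dots> \<le> dist (c j f) (c j g)"
      unfolding dist_norm by (rule component_le_norm_cart)
    also have "\<dots> \<le> dist (c j f) (x (j, f)) + dist (x (j, f)) (x (j, g)) + dist (c j g) (x (j, g))"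
      by metric
    finally show ?thesis using xc[of j f] xc[of j g] by simp
  qed
  \<comment> \<open>The l1 norm of a grid point is at most \<open>CARD('n)\<close> / 2 ^ j, and the
    perturbation accounts for the additional 1.\<close>
  have small: "norm z \<le> (real CARD('n) + 1) / 2 ^ j" if "z \<in> P j" for z j
  proof -
    obtain f where f: "f \<in> G j" "z = x (j, f)" using \<open>z \<in> P j\<close> by (auto simp: P_def)
    have "\<bar>c j f $ i\<bar> \<le> 1 / 2 ^ j" for i
    proof -
      have "f i < 2 ^ j\<^sup>2" using f(1) by (auto simp: G_def PiE_iff)
      then have "real (f i) \<le> 2 ^ j\<^sup>2"
        by (metis less_imp_le of_nat_le_iff of_nat_numeral of_nat_power)
      then have "real (f i) / 2 ^ j\<^sup>2 \<le> 1" by simp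
      then have "real (f i) / 2 ^ j\<^sup>2 / 2 ^ j \<le> 1 / 2 ^ j" by (intro divide_right_mono) auto
      then show ?thesis by (simp add: c_def \<delta>_def power_add)
    qed
    then have "(\<Sum>i\<in>UNIV. \<bar>c j f $ i\<bar>) \<le> (\<Sum>i\<in>(UNIV::'n set). 1 / 2 ^ j)"
      by (intro sum_mono)
    then have "norm (c j f) \<le> real CARD('n) / 2 ^ j"
      using norm_le_l1_cart[of "c j f"] by simp
    moreover have "\<delta> j \<le> 1 / 2 ^ j"
      unfolding \<delta>_def by (intro divide_left_mono power_increasing) auto
    moreover have "norm z \<le> norm (c j f) + dist (c j f) z"
      unfolding dist_norm by (metis norm_triangle_sub norm_minus_commute)
    ultimately have "norm z \<le> real CARD('n) / 2 ^ j + 1 / 2 ^ j"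
      using xc[of j f, folded f(2)] \<delta>[of j] by linarith
    then show ?thesis by (simp add: add_divide_distrib)
  qed

  have "compact F"
  proof (rule compact_if_finite_outside_balls)
    show "0 \<in> F" by (simp add: F_def)
    fix e :: real assume "e > 0"
    have "(\<lambda>j. (real CARD('n) + 1) / 2 ^ j) \<longlonglongrightarrow> 0" by real_asymp
    from order_tendstoD(2)[OF this \<open>e > 0\<close>]
    obtain J where J: "\<And>j. j \<ge> J \<Longrightarrow> (real CARD('n) + 1) / 2 ^ j < e"
      by (auto simp: eventually_sequentially)
    \<comment> \<open>The levels shrink towards the origin, so only finitely many finite levels
      reach outside the ball.\<close>
    have "F - ball 0 e \<subseteq> (\<Union>j<J. P j)"
    proof
      fix z assume z: "z \<in> F - ball 0 e"
      then obtain j where "z \<in> P j" using \<open>e > 0\<close> by (auto simp: F_def)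
      moreover from this have "j < J"
        using small[of z j] J[of j] z by (force simp: not_less[symmetric])
      ultimately show "z \<in> (\<Union>j<J. P j)" by blast
    qed
    then show "finite (F - ball 0 e)"
      by (rule finite_subset) (auto simp: P_def finG)
  qed
  moreover have "lower_box_dim F = ereal (real CARD('n))"
  proof (rule antisym)
    show "lower_box_dim F \<le> ereal (real CARD('n))"
      using \<open>compact F\<close> by (intro lower_box_dim_le_CARD compact_imp_bounded)
    show "ereal (real CARD('n)) \<le> lower_box_dim F"
    proof (rule CARD_le_lower_box_dim)
      show "bounded F" using \<open>compact F\<close> by (rule compact_imp_bounded)
      show "P j \<subseteq> F" for j by (auto simp: F_def)
      \<comment> \<open>The separation keeps perturbed points distinct, so no cardinality is lost in
        passing from \<open>G j\<close> to \<open>P j\<close>.\<close>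
      have "inj_on (\<lambda>f. x (j, f)) (G j)" for j
      proof (rule inj_onI, rule ccontr)
        fix f g assume "x (j, f) = x (j, g)" "f \<noteq> g"
        with sep[of f g j] \<delta>[of j] show False by simp
      qed
      then have "card (P j) = card (G j)" for j
        by (simp add: P_def card_image)
      then show "card (P j) = 2 ^ (CARD('n) * j\<^sup>2)" for j
        by (simp add: G_def card_PiE mult.commute flip: power_mult)
      show "1 / 2 ^ (j\<^sup>2 + j + 1) < dist y z" if "y \<in> P j" "z \<in> P j" "y \<noteq> z" for j y z
      proof -
        obtain f g where fg: "y = x (j, f)" "z = x (j, g)"
          using \<open>y \<in> P j\<close> \<open>z \<in> P j\<close> by (auto simp: P_def)
        with \<open>y \<noteq> z\<close> have "f \<noteq> g" by blast
        from sep[OF this, of j] show ?thesis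
          by (simp add: fg \<delta>_def mult.commute[of 2])
      qed
    qed
  qed
  moreover have "in_general_position F"
    using gp by (rule in_general_position_subset) (auto simp: F_def P_def)
  \<comment> \<open>For \<open>dim V = CARD('n) - k\<close> the slicing plane has dimension
    \<open>CARD('n) - (CARD('n) - k)\<close>, which equals k in natural number arithmetic because k
    < \<open>CARD('n)\<close>.\<close>
  ultimately show ?thesis
    by (intro exI[of _ F])
      (auto simp: grassmannian_def aff_dim_orthogonal_comp_translate
        dest!: in_general_position_Int_low_dim)
qed

end
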